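(* Let $A\in\mathbb{R}^{n\times n}$, $B\in\mathbb{R}^{n\times m}$, $C\in\mathbb{R}^{p\times n}$, $D\in\mathbb{R}^{p\times m}$, and let $Q=C^{T}C$, $S=C^{T}D$, $R=D^{T}D$. Let $W(z)=C(zI_n-A)^{-1}B+D$, let $\Phi(z)=W^{T}(z^{-1})\,W(z)$ be the spectrum associated with $\Sigma$, and let $r$ denote the normal rank of $\Phi(z)$. If $X=X^{T}\in\mathbb{R}^{n\times n}$ is a solution of CGDARE($\Sigma$), then the rank of $R_X$ is equal to $r$. If $X=X^{T}\in\mathbb{R}^{n\times n}$ is a solution of DRLMI($\Sigma$), then the rank of $R_X$ is at most equal to $r$.
   Context: $M^{\dagger}$ denotes the Moore-Penrose pseudo-inverse of $M$. For $X=X^{T}$ set $Q_X=Q+A^{T}XA-X$, $S_X=A^{T}XB+S$, $R_X=R+B^{T}XB$, and $\Pi_X=\begin{bmatrix}Q_X&S_X\\ S_X^{T}&R_X\end{bmatrix}$. With $\Sigma=(A,B;Q,R,S)$, $X=X^{T}$ is a solution of CGDARE($\Sigma$) if $X=A^{T}XA-S_XR_X^{\dagger}S_X^{T}+Q$ and $\ker R_X\subseteq\ker S_X$; it is a solution of DRLMI($\Sigma$) (discrete Riccati linear matrix inequality) if $\Pi_X\ge0$. The normal rank of a rational matrix $M(z)$ is $\max_{z\in\mathbb{C}}\operatorname{rank}M(z)$ (over the $z$ at which $M(z)$ is defined). The matrices $C,D$ come from a factorisation $\begin{bmatrix}Q&S\\ S^{T}&R\end{bmatrix}=\begin{bmatrix}C^{T}\\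 D^{T}\end{bmatrix}\begin{bmatrix}C&D\end{bmatrix}$ of the positive semidefinite Popov matrix. *)

theory Defs
  imports "HOL-Analysis.Analysis"
begin

definition mat_kernel :: "real^'m^'n \<Rightarrow> (real^'m) set" where
  "mat_kernel M = {v. M *v v = 0}"

definition psd :: "real^'n^'n \<Rightarrow> bool" where
  "psd M \<longleftrightarrow> transpose M = M \<and> (\<forall>v. 0 \<le> v \<bullet> (M *v v))"

definition is_moore_penrose :: "real^'m^'n \<Rightarrow> real^'n^'m \<Rightarrow> bool" where
  "is_moore_penrose M P \<longleftrightarrow>
     M ** P ** M = M \<and> P ** M ** P = P \<and>
     transpose (M ** P) = M ** P \<and> transpose (P ** M) = P ** M"

definition pinv :: "real^'m^'n \<Rightarrow> real^'n^'m" where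
  "pinv M = (THE P. is_moore_penrose M P)"

definition block_matrix ::
  "'a^'n^'k \<Rightarrow> 'a^'m^'k \<Rightarrow> 'a^'n^'l \<Rightarrow> 'a^'m^'l \<Rightarrow> 'a^('n + 'm)^('k + 'l)" where
  "block_matrix M11 M12 M21 M22 = (\<chi> i j. case i of
       Inl k \<Rightarrow> (case j of Inl a \<Rightarrow> M11 $ k $ a | Inr b \<Rightarrow> M12 $ k $ b)
     | Inr l \<Rightarrow> (case j of Inl a \<Rightarrow> M21 $ l $ a | Inr b \<Rightarrow> M22 $ l $ b))"

definition Q_of :: "real^'n^'n \<Rightarrow> real^'n^'n \<Rightarrow> real^'n^'n \<Rightarrow> real^'n^'n" where
  "Q_of A Q X = Q + transpose A ** X ** A - X"

definition S_of :: "real^'n^'n \<Rightarrow> real^'m^'n \<Rightarrow> real^'m^'n \<Rightarrow> real^'n^'n \<Rightarrow> real^'m^'n" where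
  "S_of A B S X = transpose A ** X ** B + S"

definition R_of :: "real^'m^'n \<Rightarrow> real^'m^'m \<Rightarrow> real^'n^'n \<Rightarrow> real^'m^'m" where
  "R_of B R X = R + transpose B ** X ** B"

definition Pi_of ::
  "real^'n^'n \<Rightarrow> real^'m^'n \<Rightarrow> real^'n^'n \<Rightarrow> real^'m^'m \<Rightarrow> real^'m^'n \<Rightarrow> real^'n^'n
     \<Rightarrow> real^('n + 'm)^('n + 'm)" where
  "Pi_of A B Q R S X =
     block_matrix (Q_of A Q X) (S_of A B S X) (transpose (S_of A B S X)) (R_of B R X)"

definition cgdare_solution ::
  "real^'n^'n \<Rightarrow> real^'m^'n \<Rightarrow> real^'n^'n \<Rightarrow> real^'m^'m \<Rightarrow> real^'m^'n \<Rightarrow> real^'n^'n \<Rightarrow> bool" where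
  "cgdare_solution A B Q R S X \<longleftrightarrow>
     transpose X = X \<and>
     X = transpose A ** X ** A
           - S_of A B S X ** pinv (R_of B R X) ** transpose (S_of A B S X) + Q \<and>
     mat_kernel (R_of B R X) \<subseteq> mat_kernel (S_of A B S X)"

definition drlmi_solution ::
  "real^'n^'n \<Rightarrow> real^'m^'n \<Rightarrow> real^'n^'n \<Rightarrow> real^'m^'m \<Rightarrow> real^'m^'n \<Rightarrow> real^'n^'n \<Rightarrow> bool" where
  "drlmi_solution A B Q R S X \<longleftrightarrow> transpose X = X \<and> psd (Pi_of A B Q R S X)"

text \<open>
  A rational matrix is represented by its evaluation map on the complex numbers together with
  the set of points at which its defining expression makes sense; the map takes irrelevant
  values elsewhere. Finitely many poles of that expression may cancel in the reduced rational
  matrix. They are excluded as well, which does not change the maximal rank, since the rank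
  at such a point cannot exceed the rank at all nearby points.
\<close>

definition normal_rank :: "complex set \<Rightarrow> (complex \<Rightarrow> complex^'m^'k) \<Rightarrow> nat" where
  "normal_rank Z M = Max {rank (M z) | z. z \<in> Z}"

definition cmat :: "real^'m^'n \<Rightarrow> complex^'m^'n" where
  "cmat = map_matrix complex_of_real"

definition transfer_dom :: "real^'n^'n \<Rightarrow> complex set" where
  "transfer_dom A = {z. invertible (mat z - cmat A)}"

definition transfer_matrix ::
  "real^'n^'n \<Rightarrow> real^'m^'n \<Rightarrow> real^'n^'p \<Rightarrow> real^'m^'p \<Rightarrow> complex \<Rightarrow> complex^'m^'p" where
  "transfer_matrix A B C D z = cmat C ** matrix_inv (mat z - cmat A) ** cmat B + cmat D"

definition spectrum_dom :: "real^'n^'n \<Rightarrow> complex set" where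
  "spectrum_dom A = {z. z \<noteq> 0 \<and> inverse z \<in> transfer_dom A \<and> z \<in> transfer_dom A}"

text \<open>The transpose below is the plain one, without complex conjugation.\<close>

definition spectrum_matrix ::
  "real^'n^'n \<Rightarrow> real^'m^'n \<Rightarrow> real^'n^'p \<Rightarrow> real^'m^'p \<Rightarrow> complex \<Rightarrow> complex^'m^'m" where
  "spectrum_matrix A B C D z =
     transpose (transfer_matrix A B C D (inverse z)) ** transfer_matrix A B C D z"

end

theory Submission
  imports Defs
begin

text \<open>
  Put \<open>F(z) = (zI - A)\<^sup>-\<^sup>1 B\<close>. Since \<open>A F(z) + B = z F(z)\<close>, replacing the Popov matrix by
  \<open>\<Pi>\<^sub>X\<close> leaves \<open>\<Phi>(z) = [F(1/z)\<^sup>T I] \<Pi> [F(z); I]\<close> unchanged for every symmetric \<open>X\<close>. In both cases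
  \<open>ker R\<^sub>X \<subseteq> ker S\<^sub>X\<close>, so \<open>S\<^sub>X\<^sup>T = R\<^sub>X K\<close> for some \<open>K\<close>, and \<open>V(z) = K F(z) + I\<close> is invertible
  whenever \<open>z\<close> is an eigenvalue of neither \<open>A\<close> nor \<open>A - B K\<close>. For a solution of the Riccati equation
  \<open>\<Phi>(z) = V(1/z)\<^sup>T R\<^sub>X V(z)\<close>, whose normal rank is the rank of \<open>R\<^sub>X\<close>. For a solution of the inequality,
  \<open>\<Phi>(z)\<close> with \<open>|z| = 1\<close> is a Hermitian form of \<open>\<Pi>\<^sub>X \<ge> 0\<close>, so \<open>\<Phi>(z) v = 0\<close> forces
  \<open>R\<^sub>X V(z) v = 0\<close>; as \<open>V(z)\<close> is invertible at some such \<open>z\<close>, the rank of \<open>R\<^sub>X\<close> is at most that of \<open>\<Phi>(z)\<close>.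
\<close>

section \<open>Matrix algebra over rings, with \<open>mat z\<close> as the scalar matrix
  \<open>z I\<close>\<close>

lemma matrix_add_rdistrib: "(A + B) ** C = A ** C + B ** C"
  by (vector matrix_matrix_mult_def sum.distrib[symmetric] field_simps)

lemma matrix_diff_ldistrib: "A ** (B - C) = A ** B - A ** (C :: 'a::ring_1^'n^'m)"
  by (vector matrix_matrix_mult_def sum_subtractf[symmetric] right_diff_distrib)

lemma matrix_diff_rdistrib: "(A - B) ** C = A ** C - B ** (C :: 'a::ring_1^'n^'m)"
  by (vector matrix_matrix_mult_def sum_subtractf[symmetric] left_diff_distrib)

lemma transpose_add: "transpose (A + B) = transpose A + transpose B"
  by (simp add: transpose_def vec_eq_iff)

lemma mat_mul_left: "mat z ** A = (\<chi> i j. z * A $ i $ j)" for A :: "'a::semiring_1^'n^'m"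
  by (simp add: matrix_matrix_mult_def mat_def vec_eq_iff if_distrib if_distribR cong: if_cong)

lemma mat_mul_right: "A ** mat z = (\<chi> i j. A $ i $ j * z)" for A :: "'a::semiring_1^'n^'m"
  by (simp add: matrix_matrix_mult_def mat_def vec_eq_iff if_distrib if_distribR cong: if_cong)

lemma mat_commute: "A ** mat z = mat z ** A" for A :: "'a::comm_semiring_1^'n^'m"
  by (simp add: mat_mul_left mat_mul_right mult.commute)

lemma mat_mult_mat: "mat a ** mat b = (mat (a * b) :: 'a::semiring_1^'n^'n)"
  by (simp add: mat_mul_left) (simp add: mat_def vec_eq_iff)

lemma mat_mult_vector: "mat z *v x = z *s x" for x :: "'a::semiring_1^'n"
  by (simp add: matrix_vector_mult_def mat_def vec_eq_iff if_distrib if_distribR cong: if_cong)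

lemma matrix_inv_inverse:
  assumes "invertible M"
  shows "M ** matrix_inv M = mat 1" "matrix_inv M ** M = mat 1"
  using assms unfolding invertible_def matrix_inv_def by (metis (mono_tags, lifting) someI_ex)+

lemma invertible_transpose_field: "invertible M \<Longrightarrow> invertible (transpose M)" for M :: "'a::field^'n^'n"
  by (simp add: invertible_det_nz)

lemma invertible_ker: "invertible M \<longleftrightarrow> (\<forall>x. M *v x = 0 \<longrightarrow> x = 0)" for M :: "'a::field^'n^'n"
  by (simp add: invertible_left_inverse matrix_left_invertible_ker)

section \<open>Rank over a field\<close>

text \<open>The rows of \<open>M ** N\<close> are the images of the rows of \<open>M\<close> under
  \<open>transpose N\<close>, and a linear map does not raise dimension.\<close>

lemma rank_mul_le_left_field: "rank (M ** N) \<le> rank M" for M :: "'a::field^'n^'m"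
proof -
  have "rows (M ** N) = (*v) (transpose N) ` rows M"
  proof -
    have "row i (M ** N) = transpose N *v row i M" for i
      by (simp add: row_def matrix_matrix_mult_def vector_matrix_mult_def vec_eq_iff)
    then show ?thesis
      by (auto simp: rows_def simp del: transpose_matrix_vector)
  qed
  then show ?thesis
    unfolding row_rank_def_gen by (metis vec.dim_image_le matrix_vector_mul_linear_gen)
qed

lemma rank_mul_le_right_field: "rank (M ** N) \<le> rank N" for M :: "'a::field^'n^'m"
proof -
  have "row i (M ** N) = (\<Sum>k\<in>UNIV. M $ i $ k *s row k N)" for i
    by (simp add: row_def matrix_matrix_mult_def vec_eq_iff)
  then have "row i (M ** N) \<in> vec.span (rows N)" for i
    by (simp only:) (intro vec.span_sum vec.span_scale vec.span_base, auto simp: rows_def)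
  then have "rows (M ** N) \<subseteq> vec.span (rows N)"
    by (auto simp: rows_def)
  then show ?thesis
    unfolding row_rank_def_gen by (metis vec.dim_mono vec.dim_span)
qed

lemma rank_le_card_field: "rank M \<le> CARD('n)" for M :: "'a::field^'n^'m"
  unfolding row_rank_def_gen by (metis dim_subset_UNIV_cart_gen)

lemma rank_mul_invertible_right: "rank (M ** N) = rank M" if "invertible N" for N :: "'a::field^'n^'n"
  by (metis antisym matrix_inv_inverse(1) matrix_mul_assoc matrix_mul_rid rank_mul_le_left_field that)

lemma rank_mul_invertible_left: "rank (N ** M) = rank M" if "invertible N" for N :: "'a::field^'n^'n"
  by (metis antisym matrix_inv_inverse(2) matrix_mul_assoc matrix_mul_lid rank_mul_le_right_field that)

text \<open>Let \<open>g\<close> be a linear right inverse of \<open>N\<close> on the range of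
  \<open>N\<close>. Then \<open>v - g (N *v v)\<close> is killed by \<open>N\<close>, hence by
  \<open>M\<close>, so \<open>Y = M ** matrix g\<close> works.\<close>

lemma factor_through_kernel:
  fixes M :: "'a::field^'n^'m" and N :: "'a^'n^'k"
  assumes "\<And>v. N *v v = 0 \<Longrightarrow> M *v v = 0"
  obtains Y where "M = Y ** N"
proof -
  obtain g where g: "Vector_Spaces.linear (*s) (*s) g" "\<And>v. N *v (g (N *v v)) = N *v v"
    using vec.linear_exists_right_inverse_on[OF matrix_vector_mul_linear_gen vec.subspace_UNIV, of N]
    by auto
  have gm: "g v = matrix g *v v" for v
    using matrix_works(1)[OF g(1)] by simp
  have "M *v v = (M ** matrix g ** N) *v v" for v
  proof -
    have "N *v (v - g (N *v v)) = 0"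
      by (simp add: matrix_vector_mult_diff_distrib g(2))
    then have "M *v (v - g (N *v v)) = 0"
      by (rule assms)
    then show ?thesis
      by (simp add: matrix_vector_mult_diff_distrib gm matrix_vector_mul_assoc matrix_mul_assoc)
  qed
  then have "M = M ** matrix g ** N"
    by (simp add: matrix_eq)
  then show ?thesis by (rule that)
qed

lemma rank_mono_kernel:
  fixes M :: "'a::field^'n^'m" and N :: "'a^'n^'k"
  assumes "\<And>v. N *v v = 0 \<Longrightarrow> M *v v = 0"
  shows "rank M \<le> rank N"
  by (metis factor_through_kernel[OF assms] rank_mul_le_right_field)

section \<open>The Moore-Penrose inverse: uniqueness and existence\<close>

text \<open>\<open>M ** P\<close> and \<open>M ** P'\<close> are both the orthogonal projection onto
  the range of \<open>M\<close>; \<open>P ** M\<close> and \<open>P' ** M\<close> are both the one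
  onto the orthogonal complement of its kernel. These two projections determine
  \<open>P = P ** M ** P\<close>.\<close>

lemma is_moore_penrose_unique:
  assumes "is_moore_penrose M P" "is_moore_penrose M P'"
  shows "P = P'"
proof -
  have a: "M ** P ** M = M" "P ** M ** P = P" "transpose (M ** P) = M ** P" "transpose (P ** M) = P ** M"
    and b: "M ** P' ** M = M" "P' ** M ** P' = P'" "transpose (M ** P') = M ** P'" "transpose (P' ** M) = P' ** M"
    using assms by (auto simp: is_moore_penrose_def)
  have "M ** P = M ** P' ** (M ** P)"
    by (metis b(1) matrix_mul_assoc)
  also have "\<dots> = transpose (M ** P ** (M ** P'))"
    by (simp only: matrix_transpose_mul[of "M ** P"] a b)
  also have "\<dots> = M ** P'"
    by (metis a(1) b(3) matrix_mul_assoc)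
  finally have 1: "M ** P = M ** P'" .
  have "P ** M = P ** M ** (P' ** M)"
    by (metis b(1) matrix_mul_assoc)
  also have "\<dots> = transpose (P' ** M ** (P ** M))"
    by (simp only: matrix_transpose_mul[of "P' ** M"] a b)
  also have "\<dots> = P' ** M"
    by (metis a(1) b(4) matrix_mul_assoc)
  finally have 2: "P ** M = P' ** M" .
  show ?thesis
    by (metis 1 2 a(2) b(2) matrix_mul_assoc)
qed

lemma gram_kernel: "transpose M *v (M *v v) = 0 \<Longrightarrow> M *v v = 0" for M :: "real^'n^'m"
  by (metis dot_lmul_matrix inner_eq_zero_iff inner_zero_left transpose_matrix_vector)

text \<open>\<open>Y\<close> solves the normal equations \<open>M\<^sup>T M Y = M\<^sup>T\<close>,
  which are solvable because \<open>M\<^sup>T M\<close> has the same kernel as \<open>M\<close>.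
  Then \<open>M ** Y\<close> is the orthogonal projection onto the range of
  \<open>M\<close>.\<close>

lemma symmetric_inner_inverse_exists:
  fixes M :: "real^'n^'m"
  obtains Y where "M ** Y ** M = M" "transpose (M ** Y) = M ** Y"
proof -
  have "M *v v = 0" if "(transpose M ** M) *v v = 0" for v
    using that gram_kernel[of M v] by (simp only: matrix_vector_mul_assoc)
  then obtain Z where Z: "M = Z ** (transpose M ** M)"
    by (rule factor_through_kernel)
  define Y where "Y = transpose Z"
  have "transpose M = transpose (Z ** (transpose M ** M))"
    by (rule arg_cong[OF Z])
  then have 1: "transpose M ** (M ** Y) = transpose M"
    by (simp only: Y_def matrix_transpose_mul transpose_transpose matrix_mul_assoc)
  have "transpose (M ** Y) ** (M ** Y) = transpose Y ** (transpose M ** (M ** Y))"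
    by (simp only: matrix_transpose_mul matrix_mul_assoc)
  then have "transpose (M ** Y) ** (M ** Y) = transpose (M ** Y)"
    by (simp only: 1 matrix_transpose_mul)
  \<comment> \<open>The left-hand side of the last identity is its own transpose, so the right-hand
    side is too.\<close>
  then have sym: "transpose (M ** Y) = M ** Y"
    by (metis matrix_transpose_mul transpose_transpose)
  have "transpose (transpose M ** (M ** Y)) = M"
    by (simp only: 1 transpose_transpose)
  then have "M ** Y ** M = M"
    by (simp only: matrix_transpose_mul[of "transpose M"] transpose_transpose sym)
  with sym show ?thesis by (rule that[rotated])
qed

text \<open>\<open>Y\<close> makes \<open>M ** Y\<close> symmetric, and the same construction for
  \<open>transpose M\<close> gives \<open>Z\<close> with \<open>Z ** M\<close> symmetric. The
  product \<open>Z ** M ** Y\<close> inherits both properties; uniqueness then settles the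
  description in \<open>pinv\<close>.\<close>

lemma is_moore_penrose_pinv: "is_moore_penrose M (pinv M)"
proof -
  obtain Y where Y: "M ** Y ** M = M" "transpose (M ** Y) = M ** Y"
    by (rule symmetric_inner_inverse_exists)
  obtain Z' where Z': "transpose M ** Z' ** transpose M = transpose M"
    "transpose (transpose M ** Z') = transpose M ** Z'"
    by (rule symmetric_inner_inverse_exists)
  define Z where "Z = transpose Z'"
  have Z: "M ** Z ** M = M" "transpose (Z ** M) = Z ** M"
    unfolding Z_def by (metis Z' matrix_mul_assoc matrix_transpose_mul transpose_transpose)+
  define P where "P = Z ** M ** Y"
  have MP: "M ** P = M ** Y" and PM: "P ** M = Z ** M"
    unfolding P_def by (metis Y(1) Z(1) matrix_mul_assoc)+
  have "is_moore_penrose M P"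
    unfolding is_moore_penrose_def MP PM using Y Z
    by (simp add: P_def) (metis Y(1) matrix_mul_assoc)
  then show ?thesis
    unfolding pinv_def by (metis is_moore_penrose_unique theI)
qed

section \<open>Complexification of real matrices\<close>

definition cvec :: "real^'n \<Rightarrow> complex^'n" where
  "cvec v = (\<chi> i. complex_of_real (v $ i))"

lemma cmat_nth [simp]: "cmat M $ i $ j = complex_of_real (M $ i $ j)"
  by (simp add: cmat_def)

lemma cmat_mult: "cmat (M ** N) = cmat M ** cmat N"
  by (simp add: matrix_matrix_mult_def vec_eq_iff)

lemma cmat_add: "cmat (M + N) = cmat M + cmat N"
  by (simp add: vec_eq_iff)

lemma cmat_diff: "cmat (M - N) = cmat M - cmat N"
  by (simp add: vec_eq_iff)

lemma cmat_transpose: "cmat (transpose M) = transpose (cmat M)"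
  by (simp add: vec_eq_iff transpose_def)

text \<open>The real and imaginary parts of a complex linear relation between real vectors are real
  linear relations.\<close>

lemma independent_cvec:
  assumes "vec.independent B"
  shows "vec.independent (cvec ` B)" "inj_on cvec B"
proof -
  show inj: "inj_on cvec B"
    by (auto simp: inj_on_def cvec_def vec_eq_iff)
  have fin: "finite B" and ind: "\<And>c. (\<Sum>v\<in>B. c v *s v) = 0 \<Longrightarrow> (\<forall>v\<in>B. c v = 0)"
    using assms by (auto simp: vec.independent_explicit)
  have "\<forall>v\<in>B. c (cvec v) = 0" if c: "(\<Sum>v\<in>cvec ` B. c v *s v) = 0" for c
  proof -
    have "(\<Sum>v\<in>B. c (cvec v) * complex_of_real (v $ i)) = 0" for i
      using arg_cong[OF c, of "\<lambda>x. x $ i"] by (simp add: sum.reindex[OF inj]) (simp add: cvec_def)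
    then have "(\<Sum>v\<in>B. Re (c (cvec v)) * v $ i) = 0 \<and> (\<Sum>v\<in>B. Im (c (cvec v)) * v $ i) = 0" for i
      by (simp add: complex_eq_iff)
    then have "\<forall>v\<in>B. Re (c (cvec v)) = 0" "\<forall>v\<in>B. Im (c (cvec v)) = 0"
      by (intro ind; simp add: vec_eq_iff)+
    then show ?thesis
      by (simp add: complex_eq_iff)
  qed
  then show "vec.independent (cvec ` B)"
    using fin by (auto simp: vec.independent_explicit)
qed

lemma span_cvec:
  fixes v :: "real^'n"
  assumes "v \<in> vec.span B"
  shows "cvec v \<in> vec.span (cvec ` B)"
  using assms
proof (induction rule: vec.span_induct_alt)
  case base
  have "cvec (0 :: real^'n) = 0"
    by (simp add: cvec_def vec_eq_iff)
  then show ?case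
    by (simp add: vec.span_zero)
next
  case (step c x y)
  have "cvec (c *s x + y) = complex_of_real c *s cvec x + cvec y"
    by (simp add: cvec_def vec_eq_iff)
  then show ?case
    using step by (auto intro: vec.span_add vec.span_scale vec.span_base)
qed

text \<open>A real basis of the row space is also a basis of the complexified row space. This links
  the real rank of \<open>R\<^sub>X\<close> to the complex rank of the spectrum.\<close>

lemma rank_cmat: "rank (cmat M) = rank M"
proof -
  obtain B where B: "B \<subseteq> rows M" "vec.independent B" "rows M \<subseteq> vec.span B" "card B = vec.dim (rows M)"
    by (rule vec.basis_exists)
  have rows: "rows (cmat M) = cvec ` rows M"
    by (force simp: rows_def row_def cvec_def)
  have "vec.dim (rows (cmat M)) = card B"
  proof (rule vec.dim_unique)
    show "cvec ` B \<subseteq> rows (cmat M)" "rows (cmat M) \<subseteq> vec.span (cvec ` B)"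
      using B span_cvec by (auto simp: rows)
  qed (simp_all add: independent_cvec[OF B(2)] card_image)
  then show ?thesis
    by (simp add: row_rank_def_gen B)
qed

section \<open>Points of the unit circle outside given spectra\<close>

text \<open>The exceptional \<open>z\<close> are the roots of the characteristic polynomial
  \<open>det P\<close>. It is not the zero polynomial, since \<open>K + 1\<close> exceeds a bound
  \<open>K\<close> for the operator norm of \<open>M\<close> and so is no eigenvalue.\<close>

lemma finite_spectrum: "finite {z. \<not> invertible (mat z - M)}" for M :: "complex^'n^'n"
proof -
  define P :: "complex poly^'n^'n" where "P = (\<chi> i j. [:- (M $ i $ j), if i = j then 1 else 0:])"
  have "poly (P $ i $ j) z = (mat z - M) $ i $ j" for i j z
    by (simp add: P_def mat_def)
  then have det: "poly (det P) z = det (mat z - M)" for z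
    by (simp add: det_def poly_sum poly_prod)
  obtain K where K: "K > 0" "\<And>x. norm (M *v x) \<le> norm x * K"
    using bounded_linear.pos_bounded[OF matrix_vector_mul_bounded_linear, of M] by blast
  have "invertible (mat (complex_of_real (K + 1)) - M)"
    unfolding invertible_ker
  proof (intro allI impI)
    fix x assume "(mat (complex_of_real (K + 1)) - M) *v x = 0"
    then have "M *v x = (K + 1) *\<^sub>R x"
      unfolding matrix_vector_mult_diff_rdistrib mat_mult_vector
      by (simp add: vec_eq_iff) (simp add: scaleR_conv_of_real algebra_simps)
    then have "(K + 1) * norm x \<le> norm x * K"
      using K(2)[of x] K(1) by simp
    then show "x = 0"
      by (simp add: algebra_simps)
  qed
  then have "det P \<noteq> 0"
    by (metis det invertible_det_nz poly_0)
  then show ?thesis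
    using poly_roots_finite[of "det P"] by (simp add: invertible_det_nz det)
qed

lemma infinite_unit_circle: "infinite {z::complex. norm z = 1}"
proof -
  have "infinite (sphere (0::complex) 1)"
  proof
    assume "finite (sphere (0::complex) 1)"
    then have "(\<exists>a. sphere (0::complex) 1 = {a}) \<or> sphere (0::complex) 1 = {}"
      using connected_finite_iff_sing[of "sphere (0::complex) 1"] connected_sphere[of "0::complex" 1] by auto
    moreover have "1 \<in> sphere (0::complex) 1" "-1 \<in> sphere (0::complex) 1" by auto
    ultimately show False
      by (metis empty_iff one_neq_neg_one singletonD)
  qed
  then show ?thesis
    by (simp add: sphere_def)
qed

lemma unit_circle_avoids_spectra:
  fixes M N :: "complex^'n^'n"
  obtains z where "norm z = 1" "invertible (mat z - M)" "invertible (mat (inverse z) - M)"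
    "invertible (mat z - N)" "invertible (mat (inverse z) - N)"
proof -
  define E where "E = {z. \<not> invertible (mat z - M)} \<union> {z. \<not> invertible (mat z - N)}"
  \<comment> \<open>Avoiding \<open>E\<close> and its image under inversion keeps both
    \<open>z\<close> and \<open>inverse z\<close> off the two spectra.\<close>
  have "finite (E \<union> inverse ` E)"
    by (simp add: E_def finite_spectrum)
  then obtain z where z: "norm z = 1" "z \<notin> E" "z \<notin> inverse ` E"
    using infinite_unit_circle by (metis (mono_tags, lifting) Un_iff finite_subset mem_Collect_eq subsetI)
  then have "inverse z \<notin> E"
    by (metis image_eqI inverse_inverse_eq)
  with z show ?thesis
    by (intro that[of z]) (auto simp: E_def)
qed

section \<open>Normal rank\<close>

lemma le_normal_rank:
  fixes M :: "complex \<Rightarrow> complex^'m^'k"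
  assumes "z \<in> Z"
  shows "rank (M z) \<le> normal_rank Z M"
proof -
  \<comment> \<open>\<open>Max\<close> is meaningful only on a finite set; the number of columns
    bounds all the ranks.\<close>
  have "finite {rank (M z) | z. z \<in> Z}"
    by (rule finite_subset[of _ "{..CARD('m)}"]) (auto simp: rank_le_card_field)
  then show ?thesis
    unfolding normal_rank_def using assms by (intro Max_ge) auto
qed

lemma normal_rank_eqI:
  assumes "z \<in> Z" "rank (M z) = k" "\<And>z. z \<in> Z \<Longrightarrow> rank (M z) \<le> k"
  shows "normal_rank Z M = k"
  unfolding normal_rank_def
proof (rule Max_eqI)
  show "finite {rank (M z) | z. z \<in> Z}"
    by (rule finite_subset[of _ "{..k}"]) (use assms in auto)
qed (use assms in auto)

section \<open>The spectrum and its invariance under the choice of \<open>X\<close>\<close>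

text \<open>Here \<open>F\<close>, \<open>G\<close> and \<open>S'\<close> stand for
  \<open>F(z)\<close>, \<open>F(1/z)\<close> and \<open>S\<^sup>T\<close>. The two resolvent
  equations turn \<open>(A G + B)\<^sup>T X (A F + B)\<close> into \<open>w z G\<^sup>T X F\<close>,
  and \<open>w * z = 1\<close> removes the scalar.\<close>

lemma popov_shift:
  fixes A X Q :: "'a::comm_ring_1^'n^'n" and B S F G :: "'a^'m^'n" and S' :: "'a^'n^'m" and R :: "'a^'m^'m"
  assumes F: "A ** F + B = mat z ** F" and G: "A ** G + B = mat w ** G" and "w * z = 1"
  shows "transpose G ** ((Q + transpose A ** X ** A - X) ** F + (transpose A ** X ** B + S))
      + ((transpose B ** X ** A + S') ** F + (R + transpose B ** X ** B))
    = transpose G ** (Q ** F + S) + (S' ** F + R)"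
proof -
  \<comment> \<open>The four \<open>X\<close>-terms with factors \<open>A\<close>, \<open>B\<close> collect to the left-hand side and cancel \<open>G\<^sup>T X F\<close>.\<close>
  have "transpose (A ** G + B) ** X ** (A ** F + B) = transpose G ** mat w ** X ** (mat z ** F)"
    by (simp add: F G matrix_transpose_mul)
  also have "\<dots> = transpose G ** (mat w ** X) ** (mat z ** F)"
    by (simp only: matrix_mul_assoc)
  also have "\<dots> = transpose G ** (X ** mat w) ** (mat z ** F)"
    by (simp only: mat_commute)
  also have "\<dots> = transpose G ** X ** (mat (w * z) ** F)"
    by (simp only: matrix_mul_assoc flip: mat_mult_mat)
  finally have "transpose G ** X ** F = transpose (A ** G + B) ** X ** (A ** F + B)"
    using assms by simp
  then show ?thesis
    by (simp add: matrix_add_ldistrib matrix_add_rdistrib matrix_diff_ldistrib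
        matrix_diff_rdistrib matrix_transpose_mul transpose_add matrix_mul_assoc)
qed

text \<open>Both directions matter: the resolvent solves the linear equation, and any solution of
  that equation can be recognised as the resolvent.\<close>

lemma resolvent_equation:
  fixes A :: "'a::comm_ring_1^'n^'n" and B :: "'a^'m^'n"
  assumes "invertible (mat z - A)"
  shows "A ** F + B = mat z ** F \<longleftrightarrow> F = matrix_inv (mat z - A) ** B"
proof -
  have "A ** F + B = mat z ** F \<longleftrightarrow> (mat z - A) ** F = B"
    by (auto simp: matrix_diff_rdistrib algebra_simps)
  also have "\<dots> \<longleftrightarrow> F = matrix_inv (mat z - A) ** B"
    using matrix_inv_inverse[OF assms] by (metis matrix_mul_assoc matrix_mul_lid)
  finally show ?thesis .
qed

text \<open>If \<open>(K F + I) v = 0\<close> and \<open>x = F v\<close>, then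
  \<open>v = - K x\<close>, so \<open>z x = A x + B v = (A - B K) x\<close>. Hence
  \<open>x = 0\<close>, and then \<open>v = 0\<close>.\<close>

lemma invertible_feedback:
  fixes A :: "'a::field^'n^'n" and B :: "'a^'m^'n"
  assumes F: "A ** F + B = mat z ** F" and inv: "invertible (mat z - (A - B ** K))"
  shows "invertible (K ** F + mat 1)"
  unfolding invertible_ker
proof (intro allI impI)
  fix v assume "(K ** F + mat 1) *v v = 0"
  then have v: "v = - (K *v (F *v v))"
    by (simp add: matrix_vector_mult_add_rdistrib matrix_vector_mul_assoc add_eq_0_iff)
  have "mat z *v (F *v v) = A *v (F *v v) + B *v v"
    by (simp add: matrix_vector_mul_assoc flip: F matrix_vector_mult_add_rdistrib)
  \<comment> \<open>Only the \<open>v\<close> next to \<open>B\<close> is rewritten, as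
    \<open>F *v v\<close> has to stay; the difference rule with first argument 0 moves the sign past
    \<open>B\<close>.\<close>
  also have "\<dots> = A *v (F *v v) - B *v (K *v (F *v v))"
    by (subst (2) v) (simp add: matrix_vector_mult_diff_distrib[of B 0, simplified])
  finally have "(mat z - (A - B ** K)) *v (F *v v) = 0"
    by (simp only: matrix_vector_mult_diff_rdistrib) (simp add: matrix_vector_mul_assoc matrix_mul_assoc)
  then have "F *v v = 0"
    using inv by (simp add: invertible_ker)
  then show "v = 0"
    using v by simp
qed

text \<open>Expanding \<open>(C G + D)\<^sup>T (C F + D)\<close> gives the form of the Popov matrix,
  which \<open>popov_shift\<close> replaces by that of \<open>\<Pi>\<^sub>X\<close>.\<close>

lemma spectrum_matrix_eq:
  fixes A X :: "real^'n^'n" and B :: "real^'m^'n" and C :: "real^'n^'p" and D :: "real^'m^'p"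
  assumes z: "z \<noteq> 0" "invertible (mat z - cmat A)" "invertible (mat (inverse z) - cmat A)"
    and X: "transpose X = X"
    and QSR: "Q = transpose C ** C" "S = transpose C ** D" "R = transpose D ** D"
    and F: "cmat A ** F + cmat B = mat z ** F"
    and G: "cmat A ** G + cmat B = mat (inverse z) ** G"
  shows "spectrum_matrix A B C D z =
    transpose G ** (cmat (Q_of A Q X) ** F + cmat (S_of A B S X))
      + (cmat (transpose (S_of A B S X)) ** F + cmat (R_of B R X))"
proof -
  have "spectrum_matrix A B C D z = transpose (cmat C ** G + cmat D) ** (cmat C ** F + cmat D)"
    using F G z by (simp add: spectrum_matrix_def transfer_matrix_def resolvent_equation
        flip: matrix_mul_assoc)
  also have "\<dots> = transpose G ** (cmat Q ** F + cmat S) + (cmat (transpose S) ** F + cmat R)"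
    by (simp add: QSR cmat_mult cmat_transpose matrix_add_ldistrib matrix_add_rdistrib
        matrix_transpose_mul transpose_add matrix_mul_assoc)
  also have "\<dots> = transpose G ** (cmat (Q_of A Q X) ** F + cmat (S_of A B S X))
      + (cmat (transpose (S_of A B S X)) ** F + cmat (R_of B R X))"
    using popov_shift[OF F G, of "cmat Q" "cmat X" "cmat S" "cmat (transpose S)" "cmat R"] z X
    by (simp add: Q_of_def S_of_def R_of_def cmat_add cmat_diff cmat_mult cmat_transpose
        transpose_add matrix_transpose_mul matrix_mul_assoc flip: cmat_transpose)
  finally show ?thesis .
qed

section \<open>Positive semidefinite forms and block matrices\<close>

text \<open>A zero of a nonnegative form is a minimum, where the gradient \<open>2 M v\<close> must
  vanish. The proof tests this along the gradient direction.\<close>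

lemma psd_kernel:
  assumes "psd M" "v \<bullet> (M *v v) = 0"
  shows "M *v v = 0"
proof (rule ccontr)
  assume "M *v v \<noteq> 0"
  define w where "w = M *v v"
  define a where "a = w \<bullet> w"
  define b where "b = w \<bullet> (M *v w)"
  \<comment> \<open>\<open>b + 1\<close> rather than \<open>b\<close>, which may vanish; then \<open>v - t w\<close> makes the form negative.\<close>
  define t where "t = a / (b + 1)"
  have sym: "transpose M = M" and nonneg: "\<And>x. 0 \<le> x \<bullet> (M *v x)"
    using assms by (auto simp: psd_def)
  have a: "a > 0" and b: "b \<ge> 0"
    using \<open>M *v v \<noteq> 0\<close> nonneg by (auto simp: a_def b_def w_def)
  have vw: "v \<bullet> (M *v w) = a"
    by (metis a_def dot_lmul_matrix sym transpose_matrix_vector w_def)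
  have "M *v (v - t *\<^sub>R w) = w - t *\<^sub>R (M *v w)"
    by (simp add: matrix_vector_mult_diff_distrib matrix_vector_mult_scaleR w_def)
  then have "(v - t *\<^sub>R w) \<bullet> (M *v (v - t *\<^sub>R w)) = t * (t * b - 2 * a)"
    using assms(2) by (simp add: inner_diff_left inner_diff_right vw flip: a_def b_def w_def)
      (simp add: algebra_simps)
  moreover have "t > 0" "t * b \<le> a"
    using a b by (auto simp: t_def field_simps)
  ultimately show False
    using nonneg[of "v - t *\<^sub>R w"] a by (simp add: zero_le_mult_iff)
qed

definition join_vec :: "'a^'n \<Rightarrow> 'a^'m \<Rightarrow> 'a^('n + 'm)" where
  "join_vec x v = (\<chi> i. case i of Inl a \<Rightarrow> x $ a | Inr b \<Rightarrow> v $ b)"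

lemma sum_UNIV_sum: "(\<Sum>i\<in>UNIV. f i) = (\<Sum>a\<in>UNIV. f (Inl a)) + (\<Sum>b\<in>UNIV. f (Inr b))"
  for f :: "'n::finite + 'm::finite \<Rightarrow> 'a::comm_monoid_add"
  by (simp add: sum.Plus flip: UNIV_Plus_UNIV)

lemma block_matrix_join_vec:
  "block_matrix M11 M12 M21 M22 *v join_vec x v
    = join_vec (M11 *v x + M12 *v v) (M21 *v x + M22 *v v)"
  by (auto simp: vec_eq_iff join_vec_def block_matrix_def matrix_vector_mult_def sum_UNIV_sum
      split: sum.split)

lemma inner_join_vec: "join_vec x v \<bullet> join_vec y w = x \<bullet> y + v \<bullet> w"
  by (simp add: inner_vec_def join_vec_def sum_UNIV_sum)

lemma psd_block:
  fixes P :: "real^'n^'n" and N :: "real^'m^'m"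
  assumes "psd (block_matrix P L L' N)"
  shows psd_block_nonneg: "0 \<le> x \<bullet> (P *v x + L *v v) + v \<bullet> (L' *v x + N *v v)"
    and psd_block_kernel: "x \<bullet> (P *v x + L *v v) + v \<bullet> (L' *v x + N *v v) = 0
      \<Longrightarrow> P *v x + L *v v = 0 \<and> L' *v x + N *v v = 0"
proof -
  show "0 \<le> x \<bullet> (P *v x + L *v v) + v \<bullet> (L' *v x + N *v v)"
    using assms unfolding psd_def by (metis block_matrix_join_vec inner_join_vec)
  assume "x \<bullet> (P *v x + L *v v) + v \<bullet> (L' *v x + N *v v) = 0"
  then have "join_vec (P *v x + L *v v) (L' *v x + N *v v) = 0"
    using psd_kernel[OF assms, of "join_vec x v"] by (simp add: block_matrix_join_vec inner_join_vec)
  then have "join_vec (P *v x + L *v v) (L' *v x + N *v v) $ Inl i = 0"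
    "join_vec (P *v x + L *v v) (L' *v x + N *v v) $ Inr j = 0" for i j
    by simp_all
  then show "P *v x + L *v v = 0 \<and> L' *v x + N *v v = 0"
    by (simp add: join_vec_def vec_eq_iff)
qed

section \<open>Hermitian forms through real and imaginary parts\<close>

definition Re_vec :: "complex^'n \<Rightarrow> real^'n" where
  "Re_vec x = (\<chi> i. Re (x $ i))"

definition Im_vec :: "complex^'n \<Rightarrow> real^'n" where
  "Im_vec x = (\<chi> i. Im (x $ i))"

lemma Re_vec_cmat: "Re_vec (cmat M *v x) = M *v Re_vec x"
  by (simp add: Re_vec_def matrix_vector_mult_def vec_eq_iff)

lemma Im_vec_cmat: "Im_vec (cmat M *v x) = M *v Im_vec x"
  by (simp add: Im_vec_def matrix_vector_mult_def vec_eq_iff)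

lemma Re_Im_vec_add:
  "Re_vec (x + y) = Re_vec x + Re_vec y" "Im_vec (x + y) = Im_vec x + Im_vec y"
  by (simp_all add: Re_vec_def Im_vec_def vec_eq_iff)

lemma Re_Im_vec_eq_0: "x = 0 \<longleftrightarrow> Re_vec x = 0 \<and> Im_vec x = 0"
  by (auto simp: Re_vec_def Im_vec_def vec_eq_iff complex_eq_iff)

text \<open>This inner product is the real part of the Hermitian one. It lets a form with real
  coefficients split into its values at the real and the imaginary part.\<close>

lemma inner_complex_vec: "x \<bullet> y = Re_vec x \<bullet> Re_vec y + Im_vec x \<bullet> Im_vec y"
  by (simp add: inner_vec_def inner_complex_def Re_vec_def Im_vec_def sum.distrib)

lemma inner_adjoint_complex:
  fixes F :: "complex^'m^'n"
  shows "v \<bullet> (transpose (map_matrix cnj F) *v p) = (F *v v) \<bullet> p"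
proof -
  have "v $ j \<bullet> (\<Sum>i\<in>UNIV. cnj (F $ i $ j) * p $ i) = (\<Sum>i\<in>UNIV. (F $ i $ j * v $ j) \<bullet> p $ i)" for j
    by (simp add: inner_sum_right) (simp add: inner_complex_def algebra_simps)
  then show ?thesis
    by (simp add: inner_vec_def matrix_vector_mult_def transpose_def inner_sum_left
        del: transpose_matrix_vector) (rule sum.swap)
qed

text \<open>\<open>A\<close> and \<open>B\<close> are real, so conjugating the entries affects only
  \<open>z\<close> and \<open>F\<close>.\<close>

lemma cnj_resolvent_equation:
  assumes "cmat A ** F + cmat B = mat z ** F"
  shows "cmat A ** map_matrix cnj F + cmat B = mat (cnj z) ** map_matrix cnj F"
proof -
  have "map_matrix cnj (cmat A ** F + cmat B) = map_matrix cnj (mat z ** F)"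
    by (simp only: assms)
  then show ?thesis
    by (simp add: matrix_matrix_mult_def vec_eq_iff mat_def if_distrib if_distribR cong: if_cong)
qed

text \<open>Pairing the hypothesis with \<open>v\<close> gives the real form at the real part of
  \<open>(F v, v)\<close> plus the same form at the imaginary part. Both values are nonnegative with
  sum zero, so both vanish and \<open>psd_block_kernel\<close> applies to each.\<close>

lemma psd_block_complex_kernel:
  fixes P :: "real^'n^'n" and N :: "real^'m^'m" and F :: "complex^'m^'n"
  assumes psd: "psd (block_matrix P L L' N)"
    and v: "(transpose (map_matrix cnj F) ** (cmat P ** F + cmat L) + (cmat L' ** F + cmat N)) *v v = 0"
  shows "(cmat L' ** F + cmat N) *v v = 0"
proof -
  define x where "x = F *v v"
  define p where "p = cmat P *v x + cmat L *v v"
  define q where "q = cmat L' *v x + cmat N *v v"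
  have q: "(cmat L' ** F + cmat N) *v v = q" and p: "(cmat P ** F + cmat L) *v v = p"
    by (simp_all add: p_def q_def x_def matrix_vector_mult_add_rdistrib matrix_vector_mul_assoc)
  have "transpose (map_matrix cnj F) *v p + q = 0"
    unfolding p[symmetric] q[symmetric] using v
    by (metis matrix_vector_mult_add_rdistrib matrix_vector_mul_assoc)
  then have "v \<bullet> (transpose (map_matrix cnj F) *v p + q) = 0"
    by simp
  then have "x \<bullet> p + v \<bullet> q = 0"
    by (simp only: inner_add_right inner_adjoint_complex x_def)
  then have sum0:
    "(Re_vec x \<bullet> (P *v Re_vec x + L *v Re_vec v) + Re_vec v \<bullet> (L' *v Re_vec x + N *v Re_vec v))
     + (Im_vec x \<bullet> (P *v Im_vec x + L *v Im_vec v) + Im_vec v \<bullet> (L' *v Im_vec x + N *v Im_vec v)) = 0"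
    by (simp add: inner_complex_vec p_def q_def Re_Im_vec_add Re_vec_cmat Im_vec_cmat)
  have "L' *v Re_vec x + N *v Re_vec v = 0" "L' *v Im_vec x + N *v Im_vec v = 0"
    using psd_block_kernel[OF psd] sum0 psd_block_nonneg[OF psd] by (metis add_nonneg_eq_0_iff)+
  then have "q = 0"
    by (simp add: Re_Im_vec_eq_0 q_def Re_Im_vec_add Re_vec_cmat Im_vec_cmat)
  with q show ?thesis by simp
qed

theorem theorem3p1:
  fixes A :: "real^'n^'n" and B :: "real^'m^'n" and C :: "real^'n^'p" and D :: "real^'m^'p"
    and Q :: "real^'n^'n" and R :: "real^'m^'m" and S :: "real^'m^'n" and r :: nat
  assumes "Q = transpose C ** C" and "S = transpose C ** D" and "R = transpose D ** D"
    and "r = normal_rank (spectrum_dom A) (spectrum_matrix A B C D)"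
  shows "(\<forall>X. cgdare_solution A B Q R S X \<longrightarrow> rank (R_of B R X) = r) \<and>
         (\<forall>X. drlmi_solution A B Q R S X \<longrightarrow> rank (R_of B R X) \<le> r)"
proof -
  define F where "F z = matrix_inv (mat z - cmat A) ** cmat B" for z
  have F: "cmat A ** F z + cmat B = mat z ** F z" if "invertible (mat z - cmat A)" for z
    unfolding F_def using resolvent_equation[OF that] by blast
  have dom: "z \<in> spectrum_dom A \<longleftrightarrow>
      z \<noteq> 0 \<and> invertible (mat z - cmat A) \<and> invertible (mat (inverse z) - cmat A)" for z
    by (auto simp: spectrum_dom_def transfer_dom_def)
  have Phi: "spectrum_matrix A B C D z =
      transpose (F (inverse z)) ** (cmat (Q_of A Q X) ** F z + cmat (S_of A B S X))
        + (cmat (transpose (S_of A B S X)) ** F z + cmat (R_of B R X))"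
    if "transpose X = X" "z \<in> spectrum_dom A" for X z
    using that assms by (intro spectrum_matrix_eq F) (auto simp: dom)
  have sym: "transpose (R_of B R X) = R_of B R X" if "transpose X = X" for X
    using that assms by (simp add: R_of_def transpose_add matrix_transpose_mul matrix_mul_assoc)
  \<comment> \<open>The kernel inclusion gives \<open>S\<^sub>X = Y R\<^sub>X\<close>; since
    \<open>R\<^sub>X\<close> is symmetric, transposing yields the gain
    \<open>K = Y\<^sup>T\<close>.\<close>
  have gain: "\<exists>K. transpose (S_of A B S X) = R_of B R X ** K"
    if "transpose X = X" "mat_kernel (R_of B R X) \<subseteq> mat_kernel (S_of A B S X)" for X
  proof -
    have "S_of A B S X *v v = 0" if "R_of B R X *v v = 0" for v
      using that \<open>mat_kernel (R_of B R X) \<subseteq> mat_kernel (S_of A B S X)\<close>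
      by (auto simp: mat_kernel_def)
    then obtain Y where "S_of A B S X = Y ** R_of B R X"
      by (rule factor_through_kernel)
    then show ?thesis
      by (metis matrix_transpose_mul sym that(1))
  qed
  \<comment> \<open>One choice of point serves both claims: the Riccati equation uses both factors,
    at \<open>z\<close> and at \<open>inverse z\<close>, and the inequality uses
    \<open>norm z = 1\<close>.\<close>
  have generic: "\<exists>z. norm z = 1 \<and> z \<in> spectrum_dom A \<and>
      invertible (cmat K ** F z + mat 1) \<and> invertible (cmat K ** F (inverse z) + mat 1)" for K
  proof -
    obtain z where z: "norm z = 1" "invertible (mat z - cmat A)" "invertible (mat (inverse z) - cmat A)"
      "invertible (mat z - (cmat A - cmat B ** cmat K))"
      "invertible (mat (inverse z) - (cmat A - cmat B ** cmat K))"
      by (rule unit_circle_avoids_spectra)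
    then show ?thesis
      by (intro exI[of _ z]) (auto simp: dom intro!: invertible_feedback[OF F])
  qed
  have "rank (R_of B R X) = r" if sol: "cgdare_solution A B Q R S X" for X
  proof -
    define Rx where "Rx = R_of B R X"
    define Sx where "Sx = S_of A B S X"
    have X: "transpose X = X"
      and ric: "X = transpose A ** X ** A - Sx ** pinv Rx ** transpose Sx + Q"
      and ker: "mat_kernel Rx \<subseteq> mat_kernel Sx"
      using sol unfolding cgdare_solution_def Rx_def Sx_def by blast+
    obtain K where K: "transpose Sx = Rx ** K"
      using gain[OF X] ker unfolding Rx_def Sx_def by blast
    have Sx: "Sx = transpose K ** Rx"
      using arg_cong[OF K, of transpose] sym[OF X] by (simp add: matrix_transpose_mul Rx_def)
    \<comment> \<open>In terms of \<open>K\<close> the pseudo-inverse disappears through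
      \<open>Rx ** pinv Rx ** Rx = Rx\<close>; the Riccati equation equates this product with
      \<open>Q\<^sub>X\<close>.\<close>
    have "Sx ** pinv Rx ** transpose Sx = transpose K ** (Rx ** pinv Rx ** Rx) ** K"
      unfolding K by (simp add: Sx matrix_mul_assoc)
    also have "\<dots> = transpose K ** Rx ** K"
      using is_moore_penrose_pinv[of Rx] by (simp add: is_moore_penrose_def)
    finally have "Q_of A Q X = transpose K ** Rx ** K"
      using ric by (simp add: Q_of_def algebra_simps)
    \<comment> \<open>The blocks of \<open>\<Pi>\<^sub>X\<close> are now those of
      \<open>[K I]\<^sup>T R\<^sub>X [K I]\<close>, so the form factors.\<close>
    then have fact: "spectrum_matrix A B C D z =
        transpose (cmat K ** F (inverse z) + mat 1) ** (cmat Rx ** (cmat K ** F z + mat 1))"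
      if "z \<in> spectrum_dom A" for z
      unfolding Phi[OF X that] Rx_def[symmetric] Sx_def[symmetric] K
      by (simp add: Sx cmat_mult cmat_transpose matrix_add_ldistrib matrix_add_rdistrib
          matrix_transpose_mul transpose_add matrix_mul_assoc)
    obtain z where z: "z \<in> spectrum_dom A"
      "invertible (cmat K ** F z + mat 1)" "invertible (cmat K ** F (inverse z) + mat 1)"
      using generic by blast
    have "normal_rank (spectrum_dom A) (spectrum_matrix A B C D) = rank (cmat Rx)"
    proof (rule normal_rank_eqI[OF z(1)])
      show "rank (spectrum_matrix A B C D z) = rank (cmat Rx)"
        using z by (simp add: fact rank_mul_invertible_left rank_mul_invertible_right
            invertible_transpose_field)
      show "rank (spectrum_matrix A B C D z) \<le> rank (cmat Rx)" if "z \<in> spectrum_dom A" for z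
        unfolding fact[OF that] by (meson order_trans rank_mul_le_left_field rank_mul_le_right_field)
    qed
    then show ?thesis
      by (simp add: assms(4) rank_cmat Rx_def)
  qed
  moreover have "rank (R_of B R X) \<le> r" if sol: "drlmi_solution A B Q R S X" for X
  proof -
    define Rx where "Rx = R_of B R X"
    define Sx where "Sx = S_of A B S X"
    have X: "transpose X = X" and psd: "psd (block_matrix (Q_of A Q X) Sx (transpose Sx) Rx)"
      using sol by (simp_all add: drlmi_solution_def Pi_of_def Rx_def Sx_def)
    \<comment> \<open>At the vector \<open>(0, v)\<close> with \<open>Rx *v v = 0\<close> the form
      vanishes, and the first block row of the kernel property reads
      \<open>Sx *v v = 0\<close>.\<close>
    have "mat_kernel Rx \<subseteq> mat_kernel Sx"
      using psd_block_kernel[OF psd, of 0] by (auto simp: mat_kernel_def)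
    then obtain K where K: "transpose Sx = Rx ** K"
      using gain[OF X] unfolding Rx_def Sx_def by blast
    obtain z where z: "norm z = 1" "z \<in> spectrum_dom A" "invertible (cmat K ** F z + mat 1)"
      using generic by blast
    have "inverse z = cnj z"
      using z(1) by (simp add: inverse_complex_def complex_eq_iff cmod_def)
    \<comment> \<open>The conjugate of \<open>F z\<close> solves the resolvent equation at
      \<open>cnj z = inverse z\<close>, whose solution is unique. The plain transpose in the
      spectrum thus becomes a conjugate transpose on the unit circle.\<close>
    then have Fbar: "F (inverse z) = map_matrix cnj (F z)"
      using z(2) cnj_resolvent_equation[OF F, of z] unfolding F_def dom
      by (metis resolvent_equation)
    have "rank (cmat Rx) = rank (cmat Rx ** (cmat K ** F z + mat 1))"
      using z(3) by (simp add: rank_mul_invertible_right)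
    also have "cmat Rx ** (cmat K ** F z + mat 1) = cmat (transpose Sx) ** F z + cmat Rx"
      by (simp add: K cmat_mult matrix_add_ldistrib matrix_mul_assoc)
    \<comment> \<open>The rank bound is a kernel inclusion: any vector killed by the spectrum at
      \<open>z\<close> is killed by the second block row of the form.\<close>
    also have "rank \<dots> \<le> rank (spectrum_matrix A B C D z)"
      using psd_block_complex_kernel[OF psd]
      by (intro rank_mono_kernel) (simp only: Phi[OF X z(2)] Fbar Rx_def Sx_def)
    also have "\<dots> \<le> r"
      unfolding assms(4) using z(2) by (rule le_normal_rank)
    finally show ?thesis
      by (simp add: rank_cmat Rx_def)
  qed
  ultimately show ?thesis by blast
qed

end
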